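(* Let $X,Y$ be normed spaces, $\phi\colon X\times Y\to\overline{\mathbb R}$ a function, $F\colon X\rightrightarrows Y$ a set-valued mapping with closed graph, and let $\mu(x):=\inf\{\phi(x,y)\mid y\in F(x)\}$ for $x\in X$. Let $x_0\in X$ with $\mu(x_0)\in\mathbb R$, and let $S(x):=\{y\in F(x)\mid\phi(x,y)=\mu(x)\}$, $x\in X$, be the solution map. Then $\mu$ is locally Lipschitzian around $x_0$ if the following conditions are satisfied: (i) $S$ is inner semicompact at $x_0$; (ii) for any $y\in S(x_0)$, the function $\phi$ is locally Lipschitzian around $(x_0,y)$ and $F$ is Lipschitz-like around $(x_0,y)$.
   Context: $\overline{\mathbb R}=\mathbb R\cup\{-\infty\}\cup\{\infty\}$ and $\inf\emptyset=\infty$. The product $X\times Y$ carries the norm $\|(x,y)\|=\|x\|+\|y\|$. An extended-real-valued function $f$ is locally Lipschitzian (locally Lipschitz continuous) around a point $x_0$ with $f(x_0)\in\mathbb R$ if there exist a neighborhood $U$ of $x_0$ on which $f$ is finite and $\ell\ge0$ with $|f(x)-f(u)|\le\ell\|x-u\|$ for all $x,u\in U$. $F$ is Lipschitz-like around $(x_0,y_0)\in\operatorname{gph}F=\{(x,y)\mid y\in F(x)\}$ if there are $\ell\ge0$ and neighborhoods $U$ of $x_0$, $V$ of $y_0$ such that $F(u)\cap V\subset F(x)+\ell\|u-x\|\mathbb B_Y$ for all $x,u\in U$, where $\mathbb B_Y$ is the closed unit ball of $Y$. A multifunction $G\colon X\rightrightarrows Y$ is inner semicompact at $x_0$ if $G(x_0)\neq\emptyset$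 and for every sequence $x_k\to x_0$ there is a sequence $y_k\in G(x_k)$ (for all $k$) such that $\{y_k\}$ has a subsequence converging to some $y_0\in G(x_0)$. *)

theory Defs
  imports "HOL-Analysis.Analysis" "HOL-Library.Set_Algebras"
begin

text \<open>The library norm on pairs is the Euclidean one,
  \<open>sqrt ((norm x)\<^sup>2 + (norm y)\<^sup>2)\<close>; here the product carries the sum norm.
  Both induce the product topology.\<close>

definition sum_norm :: "'a::real_normed_vector \<times> 'b::real_normed_vector \<Rightarrow> real" where
  "sum_norm p = norm (fst p) + norm (snd p)"

text \<open>The norm \<open>N\<close> is a parameter, to be instantiated with \<^const>\<open>norm\<close> or
  \<^const>\<open>sum_norm\<close>.\<close>

definition locally_lipschitzian_around ::
  "('a::real_normed_vector \<Rightarrow> real) \<Rightarrow> ('a \<Rightarrow> ereal) \<Rightarrow> 'a \<Rightarrow> bool" where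
  "locally_lipschitzian_around N f x0 \<longleftrightarrow>
     (\<exists>U l. open U \<and> x0 \<in> U \<and> (\<forall>x\<in>U. \<bar>f x\<bar> \<noteq> \<infinity>) \<and> 0 \<le> l \<and>
        (\<forall>x\<in>U. \<forall>u\<in>U. \<bar>f x - f u\<bar> \<le> ereal (l * N (x - u))))"

definition gph :: "('a \<Rightarrow> 'b set) \<Rightarrow> ('a \<times> 'b) set" where
  "gph F = {(x, y). y \<in> F x}"

definition lipschitz_like_around ::
  "('a::real_normed_vector \<Rightarrow> 'b::real_normed_vector set) \<Rightarrow> 'a \<times> 'b \<Rightarrow> bool" where
  "lipschitz_like_around F p \<longleftrightarrow> p \<in> gph F \<and>
     (\<exists>l U V. 0 \<le> l \<and> open U \<and> fst p \<in> U \<and> open V \<and> snd p \<in> V \<and>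
        (\<forall>x\<in>U. \<forall>u\<in>U. F u \<inter> V \<subseteq> F x + (\<lambda>b. (l * norm (u - x)) *\<^sub>R b) ` cball 0 1))"

definition inner_semicompact_at ::
  "('a::topological_space \<Rightarrow> 'b::topological_space set) \<Rightarrow> 'a \<Rightarrow> bool" where
  "inner_semicompact_at G x0 \<longleftrightarrow> G x0 \<noteq> {} \<and>
     (\<forall>x :: nat \<Rightarrow> 'a. x \<longlonglongrightarrow> x0 \<longrightarrow>
        (\<exists>y. (\<forall>k. y k \<in> G (x k)) \<and>
           (\<exists>r. strict_mono r \<and> (\<exists>y0\<in>G x0. (y \<circ> r) \<longlonglongrightarrow> y0))))"

text \<open>In \<^typ>\<open>ereal\<close> the infimum of the empty set is \<open>\<infinity>\<close>.\<close>

definition marginal :: "('a \<times> 'b \<Rightarrow> ereal) \<Rightarrow> ('a \<Rightarrow> 'b set) \<Rightarrow> 'a \<Rightarrow> ereal" where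
  "marginal \<phi> F x = (INF y\<in>F x. \<phi> (x, y))"

definition solution_map :: "('a \<times> 'b \<Rightarrow> ereal) \<Rightarrow> ('a \<Rightarrow> 'b set) \<Rightarrow> 'a \<Rightarrow> 'b set" where
  "solution_map \<phi> F x = {y \<in> F x. \<phi> (x, y) = marginal \<phi> F x}"

end

theory Submission imports Defs begin

text \<open>
  The optimal value at one point controls the optimal value at a nearby point: an optimal
  \<open>v \<in> S(u)\<close> close to some \<open>y \<in> S(x0)\<close> can be moved, by Lipschitz-likeness of \<open>F\<close>, to a feasible
  point \<open>y' \<in> F(x)\<close> at distance at most \<open>l * norm (u - x)\<close>, and the Lipschitz estimate for \<open>\<phi>\<close> then
  bounds the cost of the move. This gives \<open>\<mu>(x) \<le> \<mu>(u) + m * (1 + l) * norm (x - u)\<close>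
  (lemma \<open>marginal_le_near_feasible_point\<close>).

  The constants and neighbourhoods depend on \<open>y\<close>. Inner semicompactness makes them uniform: a
  sequence of points \<open>u\<close> violating every uniform estimate would carry solutions \<open>v \<in> S(u)\<close> that
  accumulate at some \<open>y \<in> S(x0)\<close>, where the estimate belonging to \<open>y\<close> applies
  (lemma \<open>inner_semicompact_uniform\<close>). Since the resulting one-sided inequality holds for all pairs
  of points near \<open>x0\<close>, exchanging the two points yields the absolute value.
\<close>

text \<open>
  This is the analogue, for inner semicompact maps, of extracting a finite subcover: an estimate
  at each \<open>y \<in> G x0\<close>, with a radius depending on \<open>y\<close>, yields one near \<open>x0\<close> that no longer mentions
  \<open>y\<close>. The real parameter of \<open>P\<close> encodes how weak the estimate is (smaller means weaker); in the
  application it is both the size of a neighbourhood and the reciprocal of a Lipschitz constant.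
\<close>

lemma inner_semicompact_uniform:
  fixes G :: "'a::metric_space \<Rightarrow> 'b::metric_space set" and P :: "real \<Rightarrow> 'a \<Rightarrow> bool"
  assumes "inner_semicompact_at G x0"
    and local: "\<And>y. y \<in> G x0 \<Longrightarrow> \<exists>r>0. \<forall>u\<in>ball x0 r. \<forall>v\<in>G u \<inter> ball y r. P r u"
    and antimono: "\<And>r s u. 0 < s \<Longrightarrow> s \<le> r \<Longrightarrow> P r u \<Longrightarrow> P s u"
  shows "\<exists>r>0. \<forall>u\<in>ball x0 r. P r u"
proof (rule ccontr)
  assume "\<not> ?thesis"
  then have "\<forall>n. \<exists>u\<in>ball x0 (1 / real (Suc n)). \<not> P (1 / real (Suc n)) u"
    by (metis of_nat_0_less_iff zero_less_Suc zero_less_divide_1_iff)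
  then obtain u where u: "\<And>n. u n \<in> ball x0 (1 / real (Suc n))"
    and not_P: "\<And>n. \<not> P (1 / real (Suc n)) (u n)"
    by metis
  have radii: "(\<lambda>n. 1 / real (Suc n)) \<longlonglongrightarrow> 0"
    using LIMSEQ_inverse_real_of_nat by (simp add: inverse_eq_divide)
  have "(\<lambda>n. dist (u n) x0) \<longlonglongrightarrow> 0"
    using u by (intro tendsto_sandwich[OF _ _ tendsto_const radii])
      (auto simp: dist_commute less_imp_le intro!: always_eventually)
  then have "u \<longlonglongrightarrow> x0"
    by (rule tendsto_dist_iff[THEN iffD2])
  then obtain v q y where v: "\<And>k. v k \<in> G (u k)" and q: "strict_mono q"
    and y: "y \<in> G x0" "(v \<circ> q) \<longlonglongrightarrow> y"
    using assms(1) unfolding inner_semicompact_at_def by metis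
  obtain r where r: "r > 0" and P: "\<And>u v. u \<in> ball x0 r \<Longrightarrow> v \<in> G u \<inter> ball y r \<Longrightarrow> P r u"
    using local[OF y(1)] by blast
  have "(\<lambda>k. 1 / real (Suc (q k))) \<longlonglongrightarrow> 0"
    using LIMSEQ_subseq_LIMSEQ[OF radii q] by (simp add: o_def)
  then have "eventually (\<lambda>k. 1 / real (Suc (q k)) < r) sequentially"
    using r by (rule order_tendstoD)
  moreover have "eventually (\<lambda>k. dist (v (q k)) y < r) sequentially"
    using tendstoD[OF y(2) r] by simp
  ultimately obtain k where k: "1 / real (Suc (q k)) < r" "dist (v (q k)) y < r"
    using eventually_happens'[OF sequentially_bot eventually_conj] by blast
  have "u (q k) \<in> ball x0 r"
    using u[of "q k"] k(1) by simp
  then have "P r (u (q k))"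
    using P v k(2) by (metis IntI dist_commute mem_ball)
  then have "P (1 / real (Suc (q k))) (u (q k))"
    using antimono[of "1 / real (Suc (q k))" r "u (q k)"] k(1) by simp
  then show False
    using not_P by blast
qed

lemma locally_lipschitzian_aroundI_one_sided:
  assumes "open U" "x0 \<in> U" "0 \<le> l"
    and fin: "\<And>u. u \<in> U \<Longrightarrow> \<bar>f u\<bar> \<noteq> \<infinity>"
    and le: "\<And>x u. x \<in> U \<Longrightarrow> u \<in> U \<Longrightarrow> f x \<le> f u + ereal (l * norm (x - u))"
  shows "locally_lipschitzian_around norm f x0"
proof -
  have bound: "\<bar>f x - f u\<bar> \<le> ereal (l * norm (x - u))" if xu: "x \<in> U" "u \<in> U" for x u
  proof -
    obtain a b where "f x = ereal a" "f u = ereal b"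
      using fin[OF xu(1)] fin[OF xu(2)] by (cases "f x"; cases "f u") auto
    then show ?thesis
      using le[OF xu] le[OF xu(2,1)] by (simp add: norm_minus_commute abs_le_iff)
  qed
  show ?thesis
    unfolding locally_lipschitzian_around_def
    by (intro exI[of _ U] exI[of _ l] conjI ballI)
      (rule assms(1) assms(2) assms(3) | rule fin bound; assumption)+
qed

text \<open>
  The neighbourhoods are shrunk so that the point of \<open>F x\<close> obtained by transporting a feasible \<open>v\<close>
  stays in the region where \<open>\<phi>\<close> is Lipschitz.
\<close>

lemma marginal_le_near_feasible_point:
  fixes \<phi> :: "'a::real_normed_vector \<times> 'b::real_normed_vector \<Rightarrow> ereal"
  assumes "locally_lipschitzian_around sum_norm \<phi> (x0, y)" "lipschitz_like_around F (x0, y)"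
  obtains L r where "0 \<le> L" "0 < r"
    and "\<forall>u\<in>ball x0 r. \<forall>v\<in>ball y r. \<bar>\<phi> (u, v)\<bar> \<noteq> \<infinity>"
    and "\<forall>x\<in>ball x0 r. \<forall>u\<in>ball x0 r. \<forall>v\<in>F u \<inter> ball y r.
           marginal \<phi> F x \<le> \<phi> (u, v) + ereal (L * norm (x - u))"
proof -
  obtain W m where W: "open W" "(x0, y) \<in> W" "\<forall>p\<in>W. \<bar>\<phi> p\<bar> \<noteq> \<infinity>" and m: "0 \<le> m"
    and \<phi>_lip: "\<forall>p\<in>W. \<forall>q\<in>W. \<bar>\<phi> p - \<phi> q\<bar> \<le> ereal (m * sum_norm (p - q))"
    using assms(1) unfolding locally_lipschitzian_around_def by blast
  obtain l U V where l: "0 \<le> l" and U: "open U" "x0 \<in> U" and V: "open V" "y \<in> V"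
    and F_lip: "\<forall>x\<in>U. \<forall>u\<in>U. F u \<inter> V \<subseteq> F x + (\<lambda>b. (l * norm (u - x)) *\<^sub>R b) ` cball 0 1"
    using assms(2) unfolding lipschitz_like_around_def by auto
  obtain A B where AB: "open A" "open B" "x0 \<in> A" "y \<in> B" "A \<times> B \<subseteq> W"
    using open_prod_elim[OF W(1,2)] by (metis mem_Sigma_iff)
  obtain a where a: "a > 0" "ball x0 a \<subseteq> U \<inter> A"
    using openE[of "U \<inter> A" x0] U AB(1,3) by blast
  obtain b where b: "b > 0" "ball y b \<subseteq> V \<inter> B"
    using openE[of "V \<inter> B" y] V AB(2,4) by blast
  \<comment> \<open>Points of \<open>ball x0 r\<close> are less than \<open>2 * r\<close> apart, so transporting a point of \<open>ball y r\<close>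
      leads to a distance below \<open>r + l * (2 * r) \<le> b\<close> from \<open>y\<close>.\<close>
  define r where "r = min a (b / (1 + 2 * l))"
  have r: "r > 0" "r \<le> a" "r * (1 + 2 * l) \<le> b"
  proof -
    show "r > 0" "r \<le> a"
      using a b l by (auto simp: r_def)
    have "r \<le> b / (1 + 2 * l)"
      by (simp add: r_def)
    then show "r * (1 + 2 * l) \<le> b"
      using l by (simp add: pos_le_divide_eq)
  qed
  have "r * 1 \<le> r * (1 + 2 * l)"
    using r(1) l by (intro mult_left_mono) auto
  then have "r \<le> b"
    using r(3) by linarith
  have in_W: "(u, v) \<in> W" if "u \<in> ball x0 r" "v \<in> ball y b" for u v
  proof -
    have "u \<in> A" "v \<in> B"
      using that r(2) a(2) b(2) by auto
    then show ?thesis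
      using AB(5) by blast
  qed
  have est: "marginal \<phi> F x \<le> \<phi> (u, v) + ereal (m * (1 + l) * norm (x - u))"
    if x: "x \<in> ball x0 r" and u: "u \<in> ball x0 r" and v: "v \<in> F u \<inter> ball y r" for x u v
  proof -
    have "x \<in> U" "u \<in> U" "v \<in> F u \<inter> V"
      using x u v r(2) a(2) b(2) \<open>r \<le> b\<close> by auto
    then have "v \<in> F x + (\<lambda>b. (l * norm (u - x)) *\<^sub>R b) ` cball 0 1"
      using F_lip by blast
    then obtain y' e where y': "y' \<in> F x" and e: "norm e \<le> 1" and v_eq: "v = y' + (l * norm (u - x)) *\<^sub>R e"
      by (auto simp: set_plus_def)
    have near: "norm (y' - v) \<le> l * norm (x - u)"
      using e l mult_left_mono[of "norm e" 1 "l * norm (x - u)"]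
      by (simp add: v_eq norm_minus_commute)
    have "norm (x - u) \<le> 2 * r"
      using x u dist_triangle2[of x u x0] by (simp add: dist_norm norm_minus_commute)
    then have "norm (y' - v) \<le> l * (2 * r)"
      using near l mult_left_mono order_trans by blast
    moreover have "dist y y' \<le> dist y v + norm (y' - v)"
      using dist_triangle[of y y' v] by (simp add: dist_norm norm_minus_commute)
    ultimately have "dist y y' < r * (1 + 2 * l)"
      using v by (simp add: algebra_simps)
    then have "y' \<in> ball y b"
      using r(3) by simp
    then have W1: "(x, y') \<in> W" and W2: "(u, v) \<in> W"
      using in_W x u v \<open>r \<le> b\<close> by auto
    obtain c d where cd: "\<phi> (x, y') = ereal c" "\<phi> (u, v) = ereal d"
      using W(3)[rule_format, OF W1] W(3)[rule_format, OF W2]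
      by (cases "\<phi> (x, y')"; cases "\<phi> (u, v)") auto
    have "\<bar>\<phi> (x, y') - \<phi> (u, v)\<bar> \<le> ereal (m * sum_norm ((x, y') - (u, v)))"
      using \<phi>_lip W1 W2 by blast
    then have "c - d \<le> m * (norm (x - u) + norm (y' - v))"
      using cd by (simp add: sum_norm_def)
    also have "\<dots> \<le> m * (norm (x - u) + l * norm (x - u))"
      using near m by (intro mult_left_mono) auto
    finally have "\<phi> (x, y') \<le> \<phi> (u, v) + ereal (m * (1 + l) * norm (x - u))"
      using cd by (simp add: algebra_simps)
    moreover have "marginal \<phi> F x \<le> \<phi> (x, y')"
      unfolding marginal_def using y' by (rule INF_lower)
    ultimately show ?thesis
      by (rule order_trans[rotated])
  qed
  show ?thesis
  proof (rule that[of "m * (1 + l)" r])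
    show "0 \<le> m * (1 + l)" "0 < r"
      using m l r by auto
    show "\<forall>u\<in>ball x0 r. \<forall>v\<in>ball y r. \<bar>\<phi> (u, v)\<bar> \<noteq> \<infinity>"
    proof (intro ballI)
      fix u v assume "u \<in> ball x0 r" "v \<in> ball y r"
      then have "(u, v) \<in> W"
        using \<open>r \<le> b\<close> by (intro in_W) auto
      then show "\<bar>\<phi> (u, v)\<bar> \<noteq> \<infinity>"
        using W(3) by (rule bspec[rotated])
    qed
  qed (use est in blast)
qed

theorem theorem4p11:
  fixes \<phi> :: "'a::real_normed_vector \<times> 'b::real_normed_vector \<Rightarrow> ereal"
    and F :: "'a \<Rightarrow> 'b set"
    and x0 :: 'a
  assumes closed_graph: "closed (gph F)"
    and finite_at: "\<bar>marginal \<phi> F x0\<bar> \<noteq> \<infinity>"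
    and semicompact: "inner_semicompact_at (solution_map \<phi> F) x0"
    and lipschitz: "\<And>y. y \<in> solution_map \<phi> F x0 \<Longrightarrow>
          locally_lipschitzian_around sum_norm \<phi> (x0, y) \<and> lipschitz_like_around F (x0, y)"
  shows "locally_lipschitzian_around norm (marginal \<phi> F) x0"
proof -
  let ?\<mu> = "marginal \<phi> F"
  \<comment> \<open>Shrinking \<open>r\<close> weakens this condition on \<open>u\<close> twice: \<open>x\<close> ranges over a smaller ball and the
      constant \<open>1 / r\<close> grows.\<close>
  define P where "P r u \<longleftrightarrow> \<bar>?\<mu> u\<bar> \<noteq> \<infinity> \<and>
    (\<forall>x\<in>ball x0 r. ?\<mu> x \<le> ?\<mu> u + ereal (1 / r * norm (x - u)))" for r u
  have antimono: "P s u" if "0 < s" "s \<le> r" "P r u" for r s u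
    unfolding P_def
  proof (intro conjI ballI)
    show "\<bar>?\<mu> u\<bar> \<noteq> \<infinity>"
      using that(3) by (simp add: P_def)
    fix x assume "x \<in> ball x0 s"
    then have "?\<mu> x \<le> ?\<mu> u + ereal (1 / r * norm (x - u))"
      using that by (auto simp: P_def)
    also have "\<dots> \<le> ?\<mu> u + ereal (1 / s * norm (x - u))"
    proof -
      have "1 / r * norm (x - u) \<le> 1 / s * norm (x - u)"
        using that by (intro mult_right_mono) (auto simp: frac_le)
      then show ?thesis
        by (intro add_left_mono) simp
    qed
    finally show "?\<mu> x \<le> ?\<mu> u + ereal (1 / s * norm (x - u))" .
  qed
  have "\<exists>r>0. \<forall>u\<in>ball x0 r. P r u"
  proof (rule inner_semicompact_uniform[OF semicompact])
    fix y assume "y \<in> solution_map \<phi> F x0"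
    then have "locally_lipschitzian_around sum_norm \<phi> (x0, y)" "lipschitz_like_around F (x0, y)"
      using lipschitz by blast+
    then obtain L t where L: "0 \<le> L" and t: "0 < t"
      and fin: "\<forall>u\<in>ball x0 t. \<forall>v\<in>ball y t. \<bar>\<phi> (u, v)\<bar> \<noteq> \<infinity>"
      and est: "\<forall>x\<in>ball x0 t. \<forall>u\<in>ball x0 t. \<forall>v\<in>F u \<inter> ball y t.
             ?\<mu> x \<le> \<phi> (u, v) + ereal (L * norm (x - u))"
      by (rule marginal_le_near_feasible_point) blast
    \<comment> \<open>\<open>L + 1\<close> instead of \<open>L\<close>, which may be zero.\<close>
    define r where "r = min t (1 / (L + 1))"
    have r: "0 < r" "r \<le> t"
      using t L by (auto simp: r_def)
    have "r \<le> 1 / (L + 1)"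
      by (simp add: r_def)
    then have "L \<le> 1 / r"
      using r(1) L by (simp add: field_simps)
    have "P r u" if u: "u \<in> ball x0 r" and v: "v \<in> solution_map \<phi> F u \<inter> ball y r" for u v
    proof -
      have v': "v \<in> F u" "\<phi> (u, v) = ?\<mu> u" "v \<in> ball y t" and u': "u \<in> ball x0 t"
        using u v r(2) by (auto simp: solution_map_def)
      have "?\<mu> x \<le> ?\<mu> u + ereal (1 / r * norm (x - u))" if "x \<in> ball x0 r" for x
      proof -
        have "?\<mu> x \<le> ?\<mu> u + ereal (L * norm (x - u))"
        proof -
          have "x \<in> ball x0 t"
            using that r(2) by simp
          then have "?\<mu> x \<le> \<phi> (u, v) + ereal (L * norm (x - u))"
            using est u' v'(1,3) by blast
          then show ?thesis
            by (simp only: v'(2))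
        qed
        also have "\<dots> \<le> ?\<mu> u + ereal (1 / r * norm (x - u))"
          using mult_right_mono[OF \<open>L \<le> 1 / r\<close>, of "norm (x - u)"]
          by (intro add_left_mono) simp
        finally show ?thesis .
      qed
      then show ?thesis
        using fin[rule_format, OF u' v'(3)] v'(2) by (simp add: P_def)
    qed
    then show "\<exists>r>0. \<forall>u\<in>ball x0 r. \<forall>v\<in>solution_map \<phi> F u \<inter> ball y r. P r u"
      using r(1) by blast
  qed (use antimono in blast)
  then obtain r where "0 < r" "\<And>u. u \<in> ball x0 r \<Longrightarrow> P r u"
    by blast
  then show ?thesis
    by (intro locally_lipschitzian_aroundI_one_sided[of "ball x0 r" x0 "1 / r"])
      (simp_all add: P_def)
qed

end
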